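(* No pretentious $f\in\mathcal{M}$ satisfies the local 1-Fourier uniformity property; that is, if $f\in\mathcal{M}$ is pretentious, then it is not true that $$\lim_{H\to\infty}\limsup_{M\to\infty}\frac1M\sum_{m<M}\ \sup_{\theta\in\mathbb{T}}\Big|\frac1H\sum_{h<H}f(m+h)e^{2\pi ih\theta}\Big|=0.$$
   Context: $\mathcal{M}$ is the class of multiplicative functions $f:\mathbb{N}\to\mathbb{C}$ ($f(mn)=f(m)f(n)$ for coprime $m,n$) with $|f|\le1$. $f\in\mathcal{M}$ is pretentious if there are a Dirichlet character $\chi$ and $t\in\mathbb{R}$ with $\sum_{p\text{ prime}}\frac1p\big(1-\mathrm{Re}(f(p)\overline{\chi(p)p^{it}})\big)<+\infty$. $\mathbb{T}=\mathbb{R}/\mathbb{Z}$. *)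

theory Defs
  imports "HOL-Analysis.Analysis" "HOL-Computational_Algebra.Primes"
begin

text \<open>Functions on the positive integers are represented as functions on \<^typ>\<open>nat\<close> whose value at 0
  is arbitrary; no notion below depends on that value.\<close>

definition bounded_multiplicative :: "(nat \<Rightarrow> complex) \<Rightarrow> bool" where
  "bounded_multiplicative f \<longleftrightarrow>
     (\<forall>m>0. \<forall>n>0. coprime m n \<longrightarrow> f (m * n) = f m * f n) \<and>
     (\<forall>n>0. norm (f n) \<le> 1)"

text \<open>A character of the unit group modulo \<open>q\<close>, extended by 0. The normalisation
  \<open>chi 1 = 1\<close> follows from multiplicativity and \<open>chi 1 \<noteq> 0\<close>.\<close>

definition dirichlet_character :: "nat \<Rightarrow> (nat \<Rightarrow> complex) \<Rightarrow> bool" where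
  "dirichlet_character q chi \<longleftrightarrow>
     q > 0 \<and>
     (\<forall>a. chi (a + q) = chi a) \<and>
     (\<forall>a b. chi (a * b) = chi a * chi b) \<and>
     (\<forall>a. chi a \<noteq> 0 \<longleftrightarrow> coprime a q)"

text \<open>For \<open>f\<close> bounded by 1 the terms of the series are nonnegative, so unconditional summability
  over the primes says exactly that the sum is finite.\<close>

definition pretentious :: "(nat \<Rightarrow> complex) \<Rightarrow> bool" where
  "pretentious f \<longleftrightarrow>
     (\<exists>q chi. \<exists>t::real. dirichlet_character q chi \<and>
        (\<lambda>p. 1 / real p * (1 - Re (f p * cnj (chi p * of_nat p powr (\<i> * of_real t)))))
          summable_on {p::nat. prime p})"

text \<open>The circle is represented by real representatives, the exponential being 1-periodic in
  \<open>\<theta>\<close>. All indices are positive integers. The averages lie in \<open>[0, 1]\<close> for functions bounded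
  by 1; the embedding into \<^typ>\<open>ereal\<close> only serves to have the limes superior available.\<close>

definition local_1_Fourier_uniform :: "(nat \<Rightarrow> complex) \<Rightarrow> bool" where
  "local_1_Fourier_uniform f \<longleftrightarrow>
     ((\<lambda>H::nat. limsup (\<lambda>M::nat. ereal (1 / real M * (\<Sum>m\<in>{1..<M}.
         SUP \<theta>::real. norm (1 / of_nat H *
           (\<Sum>h\<in>{1..<H}. f (m + h) * exp (2 * of_real pi * \<i> * of_nat h * of_real \<theta>)))))))
       \<longlonglongrightarrow> 0)"

end

theory Submission
  imports Defs
begin

text \<open>Suppose \<open>f\<close> is close to \<open>\<chi>(n) n\<^sup>i\<^sup>t\<close>, and let \<open>G(n) = f(n) \<chi>(n)\<^sup>* n\<^sup>-\<^sup>i\<^sup>t\<close> on odd \<open>n\<close>, \<open>G(n) = 0\<close> on even \<open>n\<close>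
  (the star is complex conjugation). The character restricted to odd numbers is periodic, hence a finite
  combination of exponentials, and \<open>n\<^sup>i\<^sup>t\<close> is almost constant on windows of length \<open>H\<close>; so local
  uniformity of \<open>f\<close> makes the partial sums of \<open>G\<close> up to \<open>M\<close> of size \<open>o(M)\<close>, and by partial summation
  the Dirichlet series of \<open>G\<close> is \<open>o(\<zeta>(s))\<close> as \<open>s\<close> decreases to 1. On the other hand, comparing Euler
  factors, the quotient of the two series has modulus at least
  \<open>\<Prod>\<^sub>p (1 - (1 - Re G(p))/p - O(1/p\<^sup>2))\<close>, which is bounded below because \<open>f\<close> is pretentious. Discarding the
  even numbers keeps the Euler factor at 2 away from 0; the other factors need no such care.\<close>

section \<open>Euler products\<close>

text \<open>The integers that appear when the Euler product over the primes in \<open>A\<close> is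
  multiplied out; 1 always belongs, as the empty product.\<close>

definition smooth_numbers :: "nat set \<Rightarrow> nat set" where
  "smooth_numbers A = {n. n > 0 \<and> (\<forall>p. prime p \<longrightarrow> p dvd n \<longrightarrow> p \<in> A)}"

lemma smooth_numbers_empty: "smooth_numbers {} = {1}"
  unfolding smooth_numbers_def using prime_factor_nat by fastforce

lemma not_dvd_smooth:
  assumes "prime p" "p \<notin> A" "m \<in> smooth_numbers A"
  shows "\<not> p dvd m"
  using assms by (auto simp: smooth_numbers_def)

text \<open>Unique factorisation with the full power of \<open>p\<close> split off: since
  \<open>p\<close> does not divide \<open>m\<close>, the exponent \<open>k\<close> is recovered as a
  multiplicity. This drives the induction that adds one prime at a time to the Euler
  product.\<close>

lemma bij_betw_smooth_numbers_insert:
  assumes p: "prime p" and "p \<notin> A" "\<forall>q\<in>A. prime q"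
  shows "bij_betw (\<lambda>(k, m). p ^ k * m) (UNIV \<times> smooth_numbers A) (smooth_numbers (insert p A))"
proof (rule bij_betw_imageI)
  show "inj_on (\<lambda>(k, m). p ^ k * m) (UNIV \<times> smooth_numbers A)"
  proof (rule inj_onI, clarify)
    fix k m k' m'
    assume m: "m \<in> smooth_numbers A" and m': "m' \<in> smooth_numbers A"
      and eq: "p ^ k * m = p ^ k' * m'"
    have mult: "multiplicity p (p ^ j * n) = j" if "n \<in> smooth_numbers A" for j n
      using not_dvd_smooth[OF p assms(2) that] p
      by (intro multiplicity_decomposeI) (auto simp: prime_gt_0_nat)
    have "k = k'" using mult[OF m, of k] mult[OF m', of k'] eq by simp
    moreover have "m = m'" using eq p \<open>k = k'\<close> by (simp add: prime_gt_0_nat)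
    ultimately show "k = k' \<and> m = m'" by simp
  qed
  show "(\<lambda>(k, m). p ^ k * m) ` (UNIV \<times> smooth_numbers A) = smooth_numbers (insert p A)"
  proof (intro equalityI subsetI)
    fix n assume "n \<in> (\<lambda>(k, m). p ^ k * m) ` (UNIV \<times> smooth_numbers A)"
    then obtain k m where n: "n = p ^ k * m" and m: "m \<in> smooth_numbers A" by auto
    have "q = p \<or> q \<in> A" if "prime q" "q dvd n" for q
    proof -
      have "q dvd p ^ k \<or> q dvd m" using that n by (simp add: prime_dvd_mult_iff)
      then show ?thesis
        using m that p by (auto simp: smooth_numbers_def dest: prime_dvd_power primes_dvd_imp_eq)
    qed
    then show "n \<in> smooth_numbers (insert p A)"
      using m n p by (auto simp: smooth_numbers_def prime_gt_0_nat)
  next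
    fix n assume n: "n \<in> smooth_numbers (insert p A)"
    then have "n \<noteq> 0" by (auto simp: smooth_numbers_def)
    moreover have "\<not> is_unit p" using p by (auto simp: not_prime_unit)
    ultimately obtain m where m: "n = p ^ multiplicity p n * m" "\<not> p dvd m"
      by (rule multiplicity_decompose')
    have "m \<in> smooth_numbers A"
      unfolding smooth_numbers_def mem_Collect_eq
    proof (intro conjI allI impI)
      show "m > 0" using \<open>n \<noteq> 0\<close> m by (metis gr0I mult_0_right)
      fix q assume "prime q" "q dvd m"
      then have "q dvd n" "q \<noteq> p" using m by (metis dvd_mult, auto)
      then show "q \<in> A" using n \<open>prime q\<close> by (auto simp: smooth_numbers_def)
    qed
    then show "n \<in> (\<lambda>(k, m). p ^ k * m) ` (UNIV \<times> smooth_numbers A)"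
      using m(1) by (intro image_eqI[of _ _ "(multiplicity p n, m)"]) auto
  qed
qed

text \<open>Adding a prime \<open>p\<close> turns the sum into a double sum over the exponent of
  \<open>p\<close> and the part prime to \<open>p\<close>. Coprimality factors each term, and
  absolute summability permits iterated summation.\<close>

lemma has_sum_finite_euler_product:
  fixes g :: "nat \<Rightarrow> complex"
  assumes one: "g 1 = 1"
    and mult: "\<And>m n. m > 0 \<Longrightarrow> n > 0 \<Longrightarrow> coprime m n \<Longrightarrow> g (m * n) = g m * g n"
    and summ: "(\<lambda>n. norm (g n)) summable_on UNIV"
    and "finite A" "\<forall>p\<in>A. prime p"
  shows "(g has_sum (\<Prod>p\<in>A. \<Sum>\<^sub>\<infinity>k. g (p ^ k))) (smooth_numbers A)"
  using \<open>finite A\<close> \<open>\<forall>p\<in>A. prime p\<close>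
proof (induction A rule: finite_induct)
  case empty
  show ?case
    using one has_sum_finite[of "{1}" g] by (simp add: smooth_numbers_empty)
next
  case (insert p A)
  let ?S = "smooth_numbers A"
  have p: "prime p" and A: "\<forall>q\<in>A. prime q" using insert.prems by auto
  note bij = bij_betw_smooth_numbers_insert[OF p insert.hyps(2) A]
  have IH: "(g has_sum (\<Prod>p\<in>A. \<Sum>\<^sub>\<infinity>k. g (p ^ k))) ?S" using insert.IH A by blast
  have split: "g (p ^ k * m) = g (p ^ k) * g m" if "m \<in> ?S" for k m
  proof -
    have "coprime p m" using not_dvd_smooth[OF p insert.hyps(2) that] p prime_imp_coprime by blast
    then show ?thesis using that p
      by (intro mult) (auto simp: smooth_numbers_def prime_gt_0_nat)
  qed
  have sum_on: "g summable_on smooth_numbers (insert p A)"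
    by (rule abs_summable_summable, rule summable_on_subset_banach[OF summ]) simp
  have inj: "inj (\<lambda>k. p ^ k)" using prime_gt_1_nat[OF p] by (simp add: inj_on_def)
  have "g summable_on range (\<lambda>k. p ^ k)"
    by (rule abs_summable_summable, rule summable_on_subset_banach[OF summ]) simp
  then have pow: "(\<lambda>k. g (p ^ k)) summable_on UNIV"
    using summable_on_reindex[OF inj, of g] by (simp add: o_def)
  have "(g has_sum infsum g (smooth_numbers (insert p A))) (smooth_numbers (insert p A))"
    using sum_on by simp
  then have "((\<lambda>(k, m). g (p ^ k * m)) has_sum infsum g (smooth_numbers (insert p A))) (UNIV \<times> ?S)"
    using has_sum_reindex_bij_betw[OF bij, of g] by (simp add: case_prod_unfold)
  then have "((\<lambda>(k, m). g (p ^ k) * g m) has_sum infsum g (smooth_numbers (insert p A))) (UNIV \<times> ?S)"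
    by (rule has_sum_cong[THEN iffD1, rotated]) (auto simp: split)
  then have "((\<lambda>k. g (p ^ k) * (\<Prod>p\<in>A. \<Sum>\<^sub>\<infinity>k. g (p ^ k))) has_sum infsum g (smooth_numbers (insert p A))) UNIV"
    by (rule has_sum_SigmaD) (auto intro!: has_sum_cmult_right IH)
  moreover have "((\<lambda>k. g (p ^ k) * (\<Prod>p\<in>A. \<Sum>\<^sub>\<infinity>k. g (p ^ k))) has_sum
      (\<Sum>\<^sub>\<infinity>k. g (p ^ k)) * (\<Prod>p\<in>A. \<Sum>\<^sub>\<infinity>k. g (p ^ k))) UNIV"
    using pow by (intro has_sum_cmult_left) simp
  ultimately have "infsum g (smooth_numbers (insert p A)) = (\<Prod>p\<in>insert p A. \<Sum>\<^sub>\<infinity>k. g (p ^ k))"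
    using insert.hyps has_sum_unique by fastforce
  then show ?case using sum_on by (metis has_sum_infsum)
qed

section \<open>Comparison of Euler factors with those of zeta\<close>

text \<open>Multiplying by \<open>1 - x\<close> divides by the corresponding factor of zeta. To
  first order the result is \<open>1 + (u 1 - 1) * x\<close>; the remainder is a geometric tail and
  one cross term, each at most \<open>x^2\<close>. Taking real parts gives the bound.\<close>

lemma euler_factor_bound:
  fixes u :: "nat \<Rightarrow> complex" and x :: real
  assumes x: "0 \<le> x" "x < 1" and u0: "u 0 = 1" and u: "\<And>k. norm (u k) \<le> 1"
    and E: "(\<lambda>k. u k * of_real x ^ k) sums E"
  shows "1 - (1 - Re (u 1)) * x - 2 * x\<^sup>2 \<le> norm E * (1 - x)"
proof -
  define R where "R = E - (1 + u 1 * of_real x)"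
  have R: "(\<lambda>k. u (k + 2) * of_real x ^ (k + 2)) sums R"
    using sums_split_initial_segment[OF E, of 2]
    by (simp add: R_def u0 numeral_2_eq_2)
  have geo: "(\<lambda>k. x ^ (k + 2)) sums (x\<^sup>2 / (1 - x))"
    using sums_mult[OF geometric_sums[of x], of "x\<^sup>2"] x
    by (simp add: power_add power2_eq_square mult_ac)
  have "norm R \<le> x\<^sup>2 / (1 - x)"
  proof -
    have "norm (\<Sum>k. u (k + 2) * of_real x ^ (k + 2)) \<le> (\<Sum>k. x ^ (k + 2))"
    proof (rule norm_suminf_le)
      show "norm (u (k + 2) * of_real x ^ (k + 2)) \<le> x ^ (k + 2)" for k
        unfolding norm_mult norm_power using x u[of "k + 2"] by (simp add: mult_left_le_one_le)
    qed (use geo in \<open>rule sums_summable\<close>)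
    then show ?thesis using R geo by (simp only: sums_iff)
  qed
  then have R_le: "(1 - x) * norm R \<le> x\<^sup>2" using x by (simp add: field_simps)
  have "1 - complex_of_real x = of_real (1 - x)" by simp
  then have norm_x: "norm (1 - complex_of_real x) = 1 - x"
    using x by (simp only: norm_of_real)
  define D where "D = (1 - of_real x) * R - u 1 * of_real (x\<^sup>2)"
  have "norm D \<le> norm ((1 - of_real x) * R) + norm (u 1 * of_real (x\<^sup>2))"
    unfolding D_def by (rule norm_triangle_ineq4)
  also have "\<dots> = (1 - x) * norm R + norm (u 1) * x\<^sup>2"
    by (simp add: norm_mult norm_power norm_x)
  also have "\<dots> \<le> 2 * x\<^sup>2"
    using R_le u[of 1] mult_right_mono[OF u[of 1], of "x\<^sup>2"] by simp
  finally have D: "norm D \<le> 2 * x\<^sup>2" .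
  have "(1 - of_real x) * E = 1 + (u 1 - 1) * of_real x + D"
    by (simp add: R_def D_def algebra_simps power2_eq_square)
  then have "Re ((1 - of_real x) * E) = 1 - (1 - Re (u 1)) * x + Re D"
    by (simp only:) (simp add: algebra_simps)
  moreover have "Re D \<ge> - norm D" using abs_Re_le_cmod[of D] by linarith
  moreover have "Re ((1 - of_real x) * E) \<le> norm ((1 - of_real x) * E)" by (rule complex_Re_le_cmod)
  moreover have "norm ((1 - of_real x) * E) = norm E * (1 - x)"
    by (simp add: norm_mult mult.commute norm_x)
  ultimately show ?thesis using D by linarith
qed

text \<open>The constants match because \<open>(1 - a) * (1 + 9 * a) = 1 + a * (8 - 9 * a)\<close>,
  which is at least 1 exactly on the interval from 0 to 8/9.\<close>

lemma exp_neg_le_one_minus: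
  fixes a :: real
  assumes "0 \<le> a" "a \<le> 8 / 9"
  shows "exp (- (9 * a)) \<le> 1 - a"
proof -
  have "1 + 9 * a \<le> exp (9 * a)" by (rule exp_ge_add_one_self)
  moreover have "1 \<le> (1 - a) * (1 + 9 * a)"
  proof -
    have "0 \<le> a * (8 - 9 * a)" using assms by simp
    then show ?thesis by (simp add: algebra_simps)
  qed
  ultimately have "1 \<le> (1 - a) * exp (9 * a)"
    using assms mult_left_mono[of "1 + 9 * a" "exp (9 * a)" "1 - a"] by linarith
  then show ?thesis by (simp add: exp_minus field_simps)
qed

text \<open>The bound is uniform in the finite set \<open>A\<close>, so it survives when
  \<open>A\<close> exhausts the primes.\<close>

lemma prod_one_minus_ge:
  fixes a :: "'a \<Rightarrow> real"
  assumes "a summable_on P" "\<And>p. p \<in> P \<Longrightarrow> 0 \<le> a p \<and> a p \<le> 8 / 9" "finite A" "A \<subseteq> P"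
  shows "exp (- 9 * infsum a P) \<le> (\<Prod>p\<in>A. 1 - a p)"
proof -
  have "sum a A \<le> infsum a P"
    using assms by (intro finite_sum_le_infsum) auto
  then have "exp (- 9 * infsum a P) \<le> exp (\<Sum>p\<in>A. - (9 * a p))"
    by (simp add: sum_negf sum_distrib_left[symmetric])
  also have "\<dots> = (\<Prod>p\<in>A. exp (- (9 * a p)))"
    using assms(3) by (simp add: exp_sum)
  also have "\<dots> \<le> (\<Prod>p\<in>A. 1 - a p)"
    using assms(2,4) exp_neg_le_one_minus by (intro prod_mono) (meson exp_ge_zero subsetD)
  finally show ?thesis .
qed

text \<open>The quotient of the two series is bounded below one prime at a time by
  \<open>1 - a p\<close>, where \<open>a\<close> is summable and independent of \<open>s\<close>;
  hence one \<open>c\<close> serves all \<open>s > 1\<close>.\<close>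

lemma dirichlet_series_lower_bound:
  fixes G :: "nat \<Rightarrow> complex"
  assumes one: "G 1 = 1"
    and mult: "\<And>m n. m > 0 \<Longrightarrow> n > 0 \<Longrightarrow> coprime m n \<Longrightarrow> G (m * n) = G m * G n"
    and le1: "\<And>n. norm (G n) \<le> 1"
    and even: "\<And>n. even n \<Longrightarrow> G n = 0"
    and summ: "(\<lambda>p. 1 / real p * (1 - Re (G p))) summable_on {p. prime p}"
  shows "\<exists>c>0. \<forall>s>1. c * (\<Sum>n. real n powr -s) \<le> norm (\<Sum>n. G n * of_real (real n powr -s))"
proof -
  define P where "P = {p::nat. prime p}"
  \<comment> \<open>At odd primes this is the loss in \<open>euler_factor_bound\<close> with
    \<open>x\<close> replaced by its upper bound \<open>1 / p\<close>. At 2 the factor of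
    \<open>G\<close> is 1, and \<open>1 - x\<close> is at least 1/2.\<close>
  define a where "a p = (if p = 2 then 1 / 2 else 1 / real p * (1 - Re (G p)) + 2 / (real p)\<^sup>2)" for p
  have Re_le: "Re (G n) \<le> 1" "Re (G n) \<ge> -1" for n
    using abs_Re_le_cmod[of "G n"] le1[of n] by linarith+
  have "(\<lambda>p::nat. 1 / (real p)\<^sup>2) summable_on UNIV"
    using inverse_power_summable[of 2, where ?'a = real]
    by (intro norm_summable_imp_summable_on) (simp add: inverse_eq_divide power_one_over)
  then have "(\<lambda>p::nat. 1 / (real p)\<^sup>2) summable_on P"
    by (rule summable_on_subset_banach) simp
  then have "(\<lambda>p::nat. 2 * (1 / (real p)\<^sup>2)) summable_on P"
    by (rule summable_on_cmult_right)
  then have "(\<lambda>p. 1 / real p * (1 - Re (G p)) + 2 / (real p)\<^sup>2) summable_on P"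
    using summ unfolding P_def by (intro summable_on_add) auto
  then have "(\<lambda>p. 1 / real p * (1 - Re (G p)) + 2 / (real p)\<^sup>2) summable_on (P - {2})"
    by (rule summable_on_subset_banach) auto
  then have "a summable_on (P - {2})"
    by (rule summable_on_cong[THEN iffD1, rotated]) (auto simp: a_def)
  then have "a summable_on (insert 2 (P - {2}))"
    by (subst summable_on_insert_iff)
  then have a_summ: "a summable_on P" by (simp add: insert_absorb P_def)
  have a_bound: "0 \<le> a p \<and> a p \<le> 8 / 9" if "p \<in> P" for p
  proof (cases "p = 2")
    case False
    then have p: "real p \<ge> 3" using that prime_ge_2_nat[of p] by (auto simp: P_def)
    \<comment> \<open>For \<open>p \<ge> 3\<close> the two terms are at most 2/3 and 2/9, which add
      up to 8/9, the limit allowed in \<open>prod_one_minus_ge\<close>.\<close>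
    have "1 / real p * (1 - Re (G p)) \<le> 1 / 3 * 2"
      using p Re_le[of p] by (intro mult_mono) (auto simp: field_simps)
    moreover have "9 \<le> (real p)\<^sup>2" using power_mono[OF p, of 2] by simp
    then have "2 / (real p)\<^sup>2 \<le> 2 / 9" using p by (intro divide_left_mono) auto
    moreover have "0 \<le> 1 / real p * (1 - Re (G p))" using Re_le[of p] by simp
    moreover have "a p = 1 / real p * (1 - Re (G p)) + 2 / (real p)\<^sup>2" using False by (simp add: a_def)
    moreover have "0 \<le> 2 / (real p)\<^sup>2" by simp
    ultimately show ?thesis by linarith
  qed (simp add: a_def)
  define c where "c = exp (- 9 * infsum a P)"
  have "c * (\<Sum>n. real n powr -s) \<le> norm (\<Sum>n. G n * of_real (real n powr -s))" if s: "s > 1" for s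
  proof -
    \<comment> \<open>By convention \<open>0 powr -s\<close> is 0, so sums over all naturals have no
      contribution from index 0.\<close>
    define w where "w n = real n powr -s" for n :: nat
    define g where "g n = G n * of_real (w n)" for n
    have w_nonneg: "w n \<ge> 0" for n by (simp add: w_def)
    have w_mult: "w (m * n) = w m * w n" for m n by (simp add: w_def powr_mult)
    have w1: "w (Suc 0) = 1" by (simp add: w_def)
    have w_pow: "w (p ^ k) = w p ^ k" for p k by (induction k) (simp_all add: w_mult w1)
    have w_summable: "summable w"
      using s summable_real_powr_iff[of "-s"] unfolding w_def by simp
    have w_on: "w summable_on A" for A
    proof (rule summable_on_subset_banach)
      show "w summable_on UNIV"
        using w_summable w_nonneg by (intro norm_summable_imp_summable_on) simp
    qed simp
    have g_le: "norm (g n) \<le> w n" for n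
      using le1[of n] w_nonneg[of n] by (simp add: g_def norm_mult mult_left_le_one_le)
    have g_abs: "(\<lambda>n. norm (g n)) summable_on A" for A
      by (rule summable_on_comparison_test[OF w_on]) (use g_le in auto)
    then have g_on: "g summable_on A" for A by (rule abs_summable_summable)
    have factor: "(1 - a p) * norm (\<Sum>\<^sub>\<infinity>k. complex_of_real (w (p ^ k))) \<le> norm (\<Sum>\<^sub>\<infinity>k. g (p ^ k))"
      if p: "p \<in> P" for p
    proof -
      define x where "x = w p"
      have p2: "p \<ge> 2" using p by (auto simp: P_def intro: prime_ge_2_nat)
      have x0: "0 \<le> x" by (simp add: x_def w_def)
      have "x \<le> real p powr -1" unfolding x_def w_def using p2 s by (intro powr_mono) auto
      then have x_le: "x \<le> 1 / real p" by (simp add: powr_minus_divide)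
      also have "\<dots> \<le> 1 / 2" using p2 by (simp add: field_simps)
      finally have x_half: "x \<le> 1 / 2" .
      then have x1: "x < 1" by simp
      have inj: "inj (\<lambda>k. p ^ k)" using p2 by (simp add: inj_on_def)
      have sums_pow: "(\<lambda>k. h (p ^ k)) sums (\<Sum>\<^sub>\<infinity>k. h (p ^ k))"
        if "\<And>A. h summable_on A" for h :: "nat \<Rightarrow> complex"
        using summable_on_reindex[OF inj, of h] that[of "range (\<lambda>k. p ^ k)"]
        by (intro has_sum_imp_sums has_sum_infsum) (simp add: o_def)
      have "(\<lambda>k. complex_of_real (w (p ^ k))) sums (\<Sum>\<^sub>\<infinity>k. complex_of_real (w (p ^ k)))"
        by (rule sums_pow) (intro summable_on_of_real w_on)
      moreover have "(\<lambda>k. complex_of_real (w (p ^ k))) sums of_real (1 / (1 - x))"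
        unfolding w_pow using geometric_sums[of x] x0 x1
        by (intro sums_of_real) (simp add: x_def)
      ultimately have "(\<Sum>\<^sub>\<infinity>k. complex_of_real (w (p ^ k))) = of_real (1 / (1 - x))"
        by (rule sums_unique2)
      then have Z: "norm (\<Sum>\<^sub>\<infinity>k. complex_of_real (w (p ^ k))) = 1 / (1 - x)"
        using x1 by (simp only: norm_of_real) simp
      have E: "(\<lambda>k. G (p ^ k) * of_real x ^ k) sums (\<Sum>\<^sub>\<infinity>k. g (p ^ k))"
        using sums_pow[OF g_on] by (simp add: g_def w_pow x_def)
      have "1 - a p \<le> norm (\<Sum>\<^sub>\<infinity>k. g (p ^ k)) * (1 - x)"
      proof (cases "p = 2")
        case True
        \<comment> \<open>All positive powers of 2 are even, so only the term \<open>k = 0\<close>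
          survives.\<close>
        have "(\<lambda>k. G (p ^ k) * of_real x ^ k) sums (\<Sum>k\<in>{0}. G (p ^ k) * of_real x ^ k)"
          using True even by (intro sums_finite) auto
        then have "(\<Sum>\<^sub>\<infinity>k. g (p ^ k)) = 1" using E one sums_unique2 by fastforce
        then show ?thesis using True x_half by (simp add: a_def)
      next
        case False
        have "(1 - Re (G p)) * x \<le> (1 - Re (G p)) * (1 / real p)"
          using x_le Re_le[of p] by (intro mult_left_mono) auto
        moreover have "x\<^sup>2 \<le> (1 / real p)\<^sup>2" using x_le x0 by (rule power_mono)
        ultimately have "1 - a p \<le> 1 - (1 - Re (G p)) * x - 2 * x\<^sup>2"
          using False by (simp add: a_def power_one_over field_simps)
        then show ?thesis
          using euler_factor_bound[OF x0 x1 _ _ E] one le1 by simp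
      qed
      then show ?thesis using x1 by (simp add: Z field_simps)
    qed
    \<comment> \<open>The finite Euler product sees only the integers in \<open>T\<close>. Outside
      \<open>T\<close> the series of \<open>g\<close> is dominated by that of \<open>w\<close>, and
      since \<open>T\<close> contains \<open>{1..N}\<close> this error is at most the tail of
      \<open>w\<close> beyond \<open>N\<close>, which vanishes in the limit.\<close>
    have main: "c * sum w {..N} \<le> norm (infsum g UNIV) + (infsum w UNIV - sum w {..N})" for N
    proof -
      define A where "A = {p. prime p \<and> p \<le> N}"
      define T where "T = smooth_numbers A"
      have A: "finite A" "A \<subseteq> P" "\<forall>p\<in>A. prime p" by (auto simp: A_def P_def)
      have sub: "{1..N} \<subseteq> T"
        by (auto simp: T_def A_def smooth_numbers_def dest: dvd_imp_le)
      have sum_w: "sum w {..N} = sum w {1..N}"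
        by (rule sum.mono_neutral_right) (auto simp: w_def)
      have G: "(g has_sum (\<Prod>p\<in>A. \<Sum>\<^sub>\<infinity>k. g (p ^ k))) T"
        unfolding T_def using A g_abs
        by (intro has_sum_finite_euler_product) (auto simp: g_def one[unfolded One_nat_def] w1 mult w_mult)
      have W: "((\<lambda>n. complex_of_real (w n)) has_sum (\<Prod>p\<in>A. \<Sum>\<^sub>\<infinity>k. complex_of_real (w (p ^ k)))) T"
        unfolding T_def using A w_on w_nonneg
        by (intro has_sum_finite_euler_product) (auto simp: w1 w_mult)
      have "((\<lambda>n. complex_of_real (w n)) has_sum complex_of_real (infsum w T)) T"
        by (intro has_sum_of_real has_sum_infsum w_on)
      then have "(\<Prod>p\<in>A. \<Sum>\<^sub>\<infinity>k. complex_of_real (w (p ^ k))) = complex_of_real (infsum w T)"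
        using W has_sum_unique by blast
      moreover have "0 \<le> infsum w T" using w_nonneg by (intro infsum_nonneg) auto
      ultimately have W': "norm (\<Prod>p\<in>A. \<Sum>\<^sub>\<infinity>k. complex_of_real (w (p ^ k))) = infsum w T"
        by simp
      have wT: "sum w {..N} \<le> infsum w T"
        unfolding sum_w using w_on w_nonneg sub by (intro finite_sum_le_infsum) auto
      have a_le1: "0 \<le> 1 - a p" if "p \<in> A" for p using a_bound[of p] A(2) that by auto
      have "c \<le> (\<Prod>p\<in>A. 1 - a p)"
        unfolding c_def by (rule prod_one_minus_ge[OF a_summ a_bound A(1,2)])
      then have "c * sum w {..N} \<le> (\<Prod>p\<in>A. 1 - a p) * infsum w T"
        using wT a_le1 w_nonneg by (intro mult_mono prod_nonneg sum_nonneg) auto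
      also have "\<dots> = (\<Prod>p\<in>A. (1 - a p) * norm (\<Sum>\<^sub>\<infinity>k. complex_of_real (w (p ^ k))))"
        by (simp only: prod.distrib prod_norm W')
      also have "\<dots> \<le> (\<Prod>p\<in>A. norm (\<Sum>\<^sub>\<infinity>k. g (p ^ k)))"
        using factor A(2) a_le1 by (intro prod_mono) auto
      also have "\<dots> = norm (infsum g T)" using infsumI[OF G] by (simp only: prod_norm)
      also have "\<dots> = norm (infsum g UNIV - infsum g (- T))"
        using infsum_Un_disjoint[OF g_on g_on, of T "- T"] by simp
      also have "\<dots> \<le> norm (infsum g UNIV) + norm (infsum g (- T))" by (rule norm_triangle_ineq4)
      also have "norm (infsum g (- T)) \<le> infsum w (- T)"
        by (rule norm_infsum_le[OF has_sum_infsum[OF g_on] has_sum_infsum[OF w_on] g_le])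
      also have "infsum w (- T) = infsum w UNIV - infsum w T"
        using infsum_Un_disjoint[OF w_on w_on, of T "- T"] by simp
      finally show ?thesis using wT by linarith
    qed
    have w_sums: "w sums infsum w UNIV" using w_on by (intro has_sum_imp_sums has_sum_infsum)
    then have lim: "(\<lambda>N. sum w {..N}) \<longlonglongrightarrow> infsum w UNIV" by (simp add: sums_def_le)
    have "c * infsum w UNIV \<le> norm (infsum g UNIV) + (infsum w UNIV - infsum w UNIV)"
      by (rule LIMSEQ_le[OF tendsto_mult_left[OF lim]
            tendsto_add[OF tendsto_const tendsto_diff[OF tendsto_const lim]]])
        (use main in auto)
    moreover have "g sums infsum g UNIV" using g_on by (intro has_sum_imp_sums has_sum_infsum)
    ultimately have "c * suminf w \<le> norm (suminf g)" using w_sums by (simp add: sums_iff)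
    then show ?thesis by (simp only: g_def[abs_def] w_def[abs_def])
  qed
  then show ?thesis by (intro exI[of _ c]) (auto simp: c_def)
qed

section \<open>Twisted means of locally uniform functions\<close>

lemma periodic_mult:
  fixes \<psi> :: "nat \<Rightarrow> 'a"
  assumes "\<And>n. \<psi> (n + q) = \<psi> n"
  shows "\<psi> (n + k * q) = \<psi> n"
proof (induction k)
  case (Suc k)
  have "\<psi> (n + Suc k * q) = \<psi> ((n + k * q) + q)" by (simp add: ac_simps)
  then show ?case using assms Suc by simp
qed simp

lemma periodic_mod:
  fixes \<psi> :: "nat \<Rightarrow> 'a"
  assumes "\<And>n. \<psi> (n + q) = \<psi> n"
  shows "\<psi> (n mod q) = \<psi> n"
  using periodic_mult[of \<psi> q "n mod q" "n div q", OF assms] by simp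

text \<open>A value of modulus above 1 would have unbounded powers, which are again values of
  \<open>chi\<close>, while periodicity leaves only finitely many values.\<close>

lemma norm_dirichlet_character_le_1:
  assumes "dirichlet_character q chi"
  shows "norm (chi a) \<le> 1"
proof (rule ccontr)
  assume "\<not> norm (chi a) \<le> 1"
  then have gt: "norm (chi a) > 1" by simp
  have q: "q > 0" and per: "\<And>n. chi (n + q) = chi n" and mult: "\<And>a b. chi (a * b) = chi a * chi b"
    using assms by (auto simp: dirichlet_character_def)
  define B where "B = Max ((\<lambda>n. norm (chi n)) ` {..<q})"
  have B: "norm (chi n) \<le> B" for n
  proof -
    have "norm (chi (n mod q)) \<le> B" unfolding B_def using q by (intro Max_ge) auto
    then show ?thesis using periodic_mod[of chi q n, OF per] by simp
  qed
  have pow: "chi (a ^ Suc k) = chi a ^ Suc k" for k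
    by (induction k) (simp_all add: mult)
  obtain k where "B < norm (chi a) ^ k" using real_arch_pow[OF gt] by blast
  also have "\<dots> \<le> norm (chi a) ^ Suc k" using gt by (intro power_increasing) auto
  also have "\<dots> = norm (chi (a ^ Suc k))" by (simp only: pow norm_power)
  also have "\<dots> \<le> B" by (rule B)
  finally show False by simp
qed

text \<open>Orthogonality of additive characters modulo \<open>q\<close>: the terms are the powers
  of a \<open>q\<close>-th root of unity \<open>z\<close>, which is 1 exactly when \<open>n\<close>
  is congruent to \<open>k\<close>; otherwise the geometric sum vanishes.\<close>

lemma sum_exp_residue:
  fixes n k q :: nat
  assumes "q > 0" "k < q"
  shows "(\<Sum>j<q. exp (2 * of_real pi * \<i> * of_nat n * of_real (real j / real q))
           * exp (- (2 * of_real pi * \<i> * of_nat k * of_real (real j / real q))))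
       = (if n mod q = k then of_nat q else (0::complex))"
proof -
  define z where "z = exp (2 * of_real pi * \<i> * of_int (int n - int k) / of_nat q :: complex)"
  have zpow: "exp (2 * of_real pi * \<i> * of_nat n * of_real (real j / real q))
           * exp (- (2 * of_real pi * \<i> * of_nat k * of_real (real j / real q))) = z ^ j" for j
    unfolding z_def exp_of_nat_mult[symmetric] exp_add[symmetric]
    by (rule arg_cong[where f = exp]) (use assms in \<open>simp add: field_simps\<close>)
  have z1: "z = 1 \<longleftrightarrow> n mod q = k"
  proof -
    have "z = 1 \<longleftrightarrow> (\<exists>m::int. 2 * pi * real_of_int (int n - int k) / real q = of_int (2 * m) * pi)"
      unfolding z_def exp_eq_1 by simp
    also have "\<dots> \<longleftrightarrow> (\<exists>m::int. real_of_int (int n - int k) = real_of_int (m * int q))"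
    proof (rule arg_cong[where f = Ex], rule ext)
      fix m :: int
      have "2 * pi * real_of_int (int n - int k) / real q = of_int (2 * m) * pi \<longleftrightarrow>
            pi * real_of_int (int n - int k) = pi * real_of_int (m * int q)"
        using assms by (auto simp: divide_eq_eq mult_ac)
      also have "\<dots> \<longleftrightarrow> real_of_int (int n - int k) = real_of_int (m * int q)" 
        by (metis mult_cancel_left pi_neq_zero)
      finally show "(2 * pi * real_of_int (int n - int k) / real q = of_int (2 * m) * pi) =
            (real_of_int (int n - int k) = real_of_int (m * int q))" .
    qed
    also have "\<dots> \<longleftrightarrow> int q dvd int n - int k" 
      by (simp only: of_int_eq_iff dvd_def mult.commute[of _ "int q"])
    also have "\<dots> \<longleftrightarrow> int n mod int q = int k mod int q" by (rule mod_eq_dvd_iff[symmetric])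
    also have "\<dots> \<longleftrightarrow> n mod q = k" using assms by (simp flip: of_nat_mod)
    finally show ?thesis .
  qed
  have zq: "z ^ q = 1"
  proof -
    have "z ^ q = exp (2 * of_int (int n - int k) * of_real pi * \<i>)"
      unfolding z_def exp_of_nat_mult[symmetric]
      by (rule arg_cong[where f = exp]) (use assms in \<open>simp add: field_simps\<close>)
    then show ?thesis using exp_integer_2pi[of "of_int (int n - int k)"] by simp
  qed
  show ?thesis
  proof (cases "z = 1")
    case True
    then show ?thesis using z1 unfolding zpow by simp
  next
    case False
    then show ?thesis using z1 unfolding zpow by (simp add: geometric_sum zq)
  qed
qed

text \<open>Twisting by a periodic function costs only the \<open>l\<^sup>1\<close> norm of its finite Fourier transform.\<close>

lemma norm_sum_periodic_twist_le:
  fixes f \<psi> :: "nat \<Rightarrow> complex"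
  assumes q: "q > 0" and per: "\<And>n. \<psi> (n + q) = \<psi> n" and le1: "\<And>n. norm (\<psi> n) \<le> 1"
    and B: "\<And>\<theta>::real. norm (\<Sum>h\<in>A. f (m + h) * exp (2 * of_real pi * \<i> * of_nat h * of_real \<theta>)) \<le> B"
  shows "norm (\<Sum>h\<in>A. f (m + h) * \<psi> (m + h)) \<le> real q * B"
proof -
  define e where "e n j = exp (2 * of_real pi * \<i> * of_nat n * of_real (real j / real q))" for n j :: nat
  define e' where "e' n j = exp (- (2 * of_real pi * \<i> * of_nat n * of_real (real j / real q)))" for n j :: nat
  have e_norm: "norm (e n j) = 1" "norm (e' n j) = 1" for n j
    unfolding e_def e'_def by (simp_all add: norm_exp_eq_Re)
  have e_add: "e (m + h) j = e m j * e h j" for h j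
    unfolding e_def by (simp add: exp_add[symmetric] algebra_simps add_divide_distrib)
  \<comment> \<open>The finite Fourier coefficients of \<open>\<psi>\<close>. Each has modulus at
    most 1, so their absolute values sum to at most \<open>q\<close>.\<close>
  define c where "c j = (\<Sum>k<q. \<psi> k * e' k j) / of_nat q" for j
  have c_le: "norm (c j) \<le> 1" for j
  proof -
    have "norm (\<Sum>k<q. \<psi> k * e' k j) \<le> (\<Sum>k<q. 1)"
      by (intro order_trans[OF norm_sum] sum_mono) (simp add: norm_mult e_norm le1)
    then show ?thesis using q by (simp add: c_def norm_divide field_simps)
  qed
  have expand: "\<psi> n = (\<Sum>j<q. c j * e n j)" for n
  proof -
    have "(\<Sum>j<q. c j * e n j) = (\<Sum>j<q. \<Sum>k<q. \<psi> k / of_nat q * (e n j * e' k j))"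
      unfolding c_def sum_divide_distrib sum_distrib_right by (simp add: mult_ac)
    also have "\<dots> = (\<Sum>k<q. \<psi> k / of_nat q * (\<Sum>j<q. e n j * e' k j))"
      by (subst sum.swap) (simp add: sum_distrib_left)
    also have "\<dots> = (\<Sum>k<q. \<psi> k / of_nat q * (if n mod q = k then of_nat q else 0))"
      unfolding e_def e'_def using q
      by (intro sum.cong refl arg_cong2[where f = "(*)"] sum_exp_residue) auto
    also have "\<dots> = \<psi> (n mod q)"
      using q by (simp add: if_distrib[of "\<lambda>x. _ * x"] cong: if_cong)
    finally show ?thesis using periodic_mod[of \<psi> q n, OF per] by simp
  qed
  \<comment> \<open>The phase \<open>e m j\<close> does not depend on \<open>h\<close> and comes out
    of the inner sum, leaving the exponential sum of hypothesis \<open>B\<close> at the frequency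
    \<open>j / q\<close>.\<close>
  have "(\<Sum>h\<in>A. f (m + h) * \<psi> (m + h)) = (\<Sum>h\<in>A. \<Sum>j<q. c j * e m j * (f (m + h) * e h j))"
    by (simp add: expand e_add sum_distrib_left mult_ac)
  also have "\<dots> = (\<Sum>j<q. c j * e m j * (\<Sum>h\<in>A. f (m + h) * e h j))"
    by (subst sum.swap) (simp add: sum_distrib_left)
  also have "norm \<dots> \<le> (\<Sum>j<q. B)"
  proof (intro order_trans[OF norm_sum] sum_mono)
    fix j
    have "norm (c j * e m j * (\<Sum>h\<in>A. f (m + h) * e h j)) \<le> 1 * norm (\<Sum>h\<in>A. f (m + h) * e h j)"
      unfolding norm_mult e_norm mult_1_right using c_le by (intro mult_right_mono) auto
    also have "\<dots> \<le> B" using B[of "real j / real q"] by (simp add: e_def)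
    finally show "norm (c j * e m j * (\<Sum>h\<in>A. f (m + h) * e h j)) \<le> B" .
  qed
  finally show ?thesis by simp
qed

section \<open>Slow variation of \<open>n^(it)\<close> and passage from windows to long sums\<close>

text \<open>Each unit shift telescopes to two boundary terms, each of norm at most 1.\<close>

lemma norm_sum_shift_le:
  fixes G :: "nat \<Rightarrow> 'a::real_normed_vector"
  assumes "\<And>n. norm (G n) \<le> 1"
  shows "norm ((\<Sum>m\<in>{1..<M}. G (m + h)) - (\<Sum>m\<in>{1..<M}. G m)) \<le> 2 * real h"
proof (induction h)
  case (Suc h)
  have "norm ((\<Sum>m\<in>{1..<M}. G (m + Suc h)) - (\<Sum>m\<in>{1..<M}. G (m + h))) \<le> 2"
  proof (cases "M \<ge> 1")
    case True
    have "(\<Sum>m\<in>{1..<M}. G (Suc m + h) - G (m + h)) = G (M + h) - G (1 + h)"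
      using sum_Suc_diff'[OF True, of "\<lambda>m. G (m + h)"] by simp
    then have "(\<Sum>m\<in>{1..<M}. G (m + Suc h)) - (\<Sum>m\<in>{1..<M}. G (m + h)) = G (M + h) - G (1 + h)"
      by (simp add: sum_subtractf)
    moreover have "norm (G (M + h) - G (1 + h)) \<le> norm (G (M + h)) + norm (G (1 + h))"
      by (rule norm_triangle_ineq4)
    ultimately show ?thesis using assms[of "M + h"] assms[of "1 + h"] by simp
  qed auto
  moreover have "norm ((\<Sum>m\<in>{1..<M}. G (m + Suc h)) - (\<Sum>m\<in>{1..<M}. G m)) \<le>
      norm ((\<Sum>m\<in>{1..<M}. G (m + Suc h)) - (\<Sum>m\<in>{1..<M}. G (m + h))) +
      norm ((\<Sum>m\<in>{1..<M}. G (m + h)) - (\<Sum>m\<in>{1..<M}. G m))"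
    by (rule order_trans[OF _ norm_triangle_ineq]) simp
  ultimately show ?case using Suc by simp
qed simp

lemma norm_nat_powr_imaginary:
  "n > 0 \<Longrightarrow> norm (of_nat n powr (\<i> * of_real t)) = 1"
  by (simp add: norm_powr_real)

text \<open>Writing \<open>n^(it)\<close> as \<open>exp (i t ln n)\<close>, the claim follows
  because \<open>a \<mapsto> exp (i a)\<close> is 1-Lipschitz on the reals and
  \<open>ln (1 + h / m) \<le> h / m\<close>.\<close>

lemma norm_powr_imaginary_diff_le:
  assumes "m > 0"
  shows "norm (of_nat (m + h) powr (\<i> * of_real t) - of_nat m powr (\<i> * of_real t)) \<le> \<bar>t\<bar> * real h / real m"
proof -
  have powr: "of_nat n powr (\<i> * of_real t) = exp (\<i> * of_real (t * ln (real n)))" if "n > 0" for n :: nat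
    using that by (simp add: powr_def mult_ac Ln_of_nat)
  have "norm (exp (\<i> * of_real a) - exp (\<i> * of_real b)) \<le> \<bar>a - b\<bar>" for a b :: real
  proof -
    have "exp (\<i> * of_real a) - exp (\<i> * of_real b) = exp (\<i> * of_real b) * (exp (\<i> * of_real (a - b)) - 1)"
      by (simp add: algebra_simps exp_diff)
    then have "norm (exp (\<i> * of_real a) - exp (\<i> * of_real b)) = norm (exp (\<i> * of_real (a - b)) - 1)"
      by (simp add: norm_mult)
    also have "\<dots> = 2 * \<bar>sin ((a - b) / 2)\<bar>" by (rule dist_exp_i_1)
    also have "\<dots> \<le> \<bar>a - b\<bar>" using abs_sin_x_le_abs_x[of "(a - b) / 2"] by simp
    finally show ?thesis .
  qed
  note exp_diff_le = this[of "t * ln (real (m + h))" "t * ln (real m)"]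
  have "norm (of_nat (m + h) powr (\<i> * of_real t) - of_nat m powr (\<i> * of_real t))
      \<le> \<bar>t\<bar> * \<bar>ln (real (m + h)) - ln (real m)\<bar>"
    using exp_diff_le assms
    by (simp only: powr add_pos_nonneg zero_le abs_mult flip: right_diff_distrib)
  also have "\<dots> \<le> \<bar>t\<bar> * (real h / real m)"
  proof (rule mult_left_mono)
    have "1 + real h / real m = real (m + h) / real m" using assms by (simp add: field_simps)
    then have "ln (real (m + h)) - ln (real m) = ln (1 + real h / real m)"
      using assms by (simp add: ln_div)
    moreover have "\<dots> \<le> real h / real m" by (rule ln_add_one_self_le_self) simp
    moreover have "ln (real m) \<le> ln (real (m + h))" using assms by simp
    ultimately show "\<bar>ln (real (m + h)) - ln (real m)\<bar> \<le> real h / real m" by simp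
  qed simp
  finally show ?thesis by simp
qed

text \<open>A crude bound on the accumulated errors \<open>1 / m\<close> from slow variation; growth
  slower than \<open>M\<close> is all that matters.\<close>

lemma sum_inverse_le_sqrt: "(\<Sum>m\<in>{1..<M}. 1 / real m) \<le> 3 * sqrt (real M)"
proof (induction M)
  case (Suc M)
  show ?case
  proof (cases "M = 0")
    case False
    then have M: "real M \<ge> 1" by simp
    define a b where "a = sqrt (real M)" and "b = sqrt (real (Suc M))"
    have "b \<le> sqrt (2\<^sup>2 * real M)" unfolding b_def using M by (intro real_sqrt_le_mono) simp
    then have b: "b \<le> 2 * a" by (simp add: a_def real_sqrt_mult)
    have a: "1 \<le> a" "a\<^sup>2 = real M" "a \<le> b" "b\<^sup>2 = real M + 1"
      using M by (simp_all add: a_def b_def)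
    \<comment> \<open>The increment of the square root is compared with \<open>1 / M\<close>; the
      constant 3 arises from \<open>b + a \<le> 3 * a \<le> 3 * a^2\<close>.\<close>
    have "1 = (b - a) * (b + a)" using a by (simp add: algebra_simps power2_eq_square)
    also have "\<dots> \<le> (b - a) * (3 * a\<^sup>2)"
    proof (rule mult_left_mono)
      show "b + a \<le> 3 * a\<^sup>2" using b a(1) power_increasing[of 1 2 a] by simp
    qed (use a in simp)
    finally have "1 / real M \<le> 3 * b - 3 * a" using M a by (simp add: field_simps)
    then show ?thesis using Suc False by (simp add: a_def b_def)
  qed simp
qed simp

text \<open>The factor \<open>n^(-it)\<close> is frozen at \<open>n = m\<close>, where it is
  unimodular and leaves the sum; the periodic twist is then absorbed by the supremum over
  frequencies. Freezing costs at most \<open>\<bar>t\<bar> * H / m\<close> for each of fewer than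
  \<open>H\<close> terms.\<close>

lemma norm_sum_twist_slow_le:
  fixes f \<psi> :: "nat \<Rightarrow> complex" and t :: real
  assumes H: "H > 0" and m: "m > 0"
    and f: "\<And>n. n > 0 \<Longrightarrow> norm (f n) \<le> 1"
    and q: "q > 0" and per: "\<And>n. \<psi> (n + q) = \<psi> n" and \<psi>: "\<And>n. norm (\<psi> n) \<le> 1"
  shows "norm (\<Sum>h\<in>{1..<H}. f (m + h) * \<psi> (m + h) * cnj (of_nat (m + h) powr (\<i> * of_real t))) \<le>
    real q * (real H * (SUP \<theta>::real. norm (1 / of_nat H *
           (\<Sum>h\<in>{1..<H}. f (m + h) * exp (2 * of_real pi * \<i> * of_nat h * of_real \<theta>)))))
    + \<bar>t\<bar> * (real H)\<^sup>2 * (1 / real m)"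
proof -
  define F where "F \<theta> = norm (1 / of_nat H *
           (\<Sum>h\<in>{1..<H}. f (m + h) * exp (2 * of_real pi * \<i> * of_nat h * of_real \<theta>)))" for \<theta> :: real
  define T where "T n = cnj (of_nat n powr (\<i> * of_real t))" for n :: nat
  have card: "(\<Sum>h\<in>{1..<H}. 1 :: real) \<le> real H" by simp
  have e: "norm (exp (2 * of_real pi * \<i> * of_nat h * of_real \<theta>)) = 1" for h :: nat and \<theta> :: real
    by (simp add: norm_exp_eq_Re)
  have "F \<theta> \<le> 1" for \<theta>
  proof -
    have "norm (\<Sum>h\<in>{1..<H}. f (m + h) * exp (2 * of_real pi * \<i> * of_nat h * of_real \<theta>)) \<le> (\<Sum>h\<in>{1..<H}. 1)"
      using f m by (intro order_trans[OF norm_sum] sum_mono) (simp add: norm_mult e)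
    with card show ?thesis using H by (simp add: F_def norm_mult norm_divide field_simps)
  qed
  \<comment> \<open>A real supremum bounds its family only when that family is bounded
    above.\<close>
  then have bdd: "bdd_above (range F)" by (intro bdd_aboveI[of _ 1]) auto
  have "norm (\<Sum>h\<in>{1..<H}. f (m + h) * \<psi> (m + h)) \<le> real q * (real H * (SUP \<theta>. F \<theta>))"
  proof (rule norm_sum_periodic_twist_le[where \<psi> = \<psi>, OF q per \<psi>])
    fix \<theta> :: real
    have "norm (\<Sum>h\<in>{1..<H}. f (m + h) * exp (2 * of_real pi * \<i> * of_nat h * of_real \<theta>)) = real H * F \<theta>"
      using H by (simp add: F_def norm_mult norm_divide)
    also have "\<dots> \<le> real H * (SUP \<theta>. F \<theta>)"
      by (intro mult_left_mono cSUP_upper bdd) auto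
    finally show "norm (\<Sum>h\<in>{1..<H}. f (m + h) * exp (2 * of_real pi * \<i> * of_nat h * of_real \<theta>)) \<le> \<dots>" .
  qed
  moreover have "norm (T m) = 1" using m by (simp add: T_def norm_nat_powr_imaginary)
  ultimately have main: "norm (T m * (\<Sum>h\<in>{1..<H}. f (m + h) * \<psi> (m + h))) \<le> real q * (real H * (SUP \<theta>. F \<theta>))"
    by (simp add: norm_mult)
  have "norm (\<Sum>h\<in>{1..<H}. f (m + h) * \<psi> (m + h) * (T (m + h) - T m)) \<le> (\<Sum>h\<in>{1..<H}. \<bar>t\<bar> * real H / real m)"
  proof (intro order_trans[OF norm_sum] sum_mono)
    fix h assume h: "h \<in> {1..<H}"
    have "norm (T (m + h) - T m) \<le> \<bar>t\<bar> * real h / real m"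
      using norm_powr_imaginary_diff_le[OF m, of h t]
      unfolding T_def complex_cnj_diff[symmetric] complex_mod_cnj .
    also have "\<dots> \<le> \<bar>t\<bar> * real H / real m"
      using h by (intro divide_right_mono mult_left_mono) auto
    finally have "norm (T (m + h) - T m) \<le> \<bar>t\<bar> * real H / real m" .
    moreover have "norm (f (m + h)) * norm (\<psi> (m + h)) \<le> 1 * 1"
      using f m \<psi> by (intro mult_mono) auto
    ultimately have "norm (f (m + h)) * norm (\<psi> (m + h)) * norm (T (m + h) - T m) \<le> 1 * (\<bar>t\<bar> * real H / real m)"
      by (intro mult_mono) auto
    then show "norm (f (m + h) * \<psi> (m + h) * (T (m + h) - T m)) \<le> \<bar>t\<bar> * real H / real m"
      by (simp add: norm_mult)
  qed
  also have "\<dots> = (\<Sum>h\<in>{1..<H}. 1) * (\<bar>t\<bar> * real H / real m)" by simp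
  also have "\<dots> \<le> real H * (\<bar>t\<bar> * real H / real m)" by (intro mult_right_mono card) simp
  also have "\<dots> = \<bar>t\<bar> * (real H)\<^sup>2 * (1 / real m)" by (simp add: power2_eq_square)
  finally have err: "norm (\<Sum>h\<in>{1..<H}. f (m + h) * \<psi> (m + h) * (T (m + h) - T m)) \<le> \<dots>" .
  have "(\<Sum>h\<in>{1..<H}. f (m + h) * \<psi> (m + h) * T (m + h)) =
      T m * (\<Sum>h\<in>{1..<H}. f (m + h) * \<psi> (m + h)) + (\<Sum>h\<in>{1..<H}. f (m + h) * \<psi> (m + h) * (T (m + h) - T m))"
    by (simp add: sum_distrib_left sum.distrib[symmetric] algebra_simps)
  also have "norm \<dots> \<le> real q * (real H * (SUP \<theta>. F \<theta>)) + \<bar>t\<bar> * (real H)\<^sup>2 * (1 / real m)"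
    using main err by (intro norm_triangle_mono)
  finally show ?thesis by (simp add: T_def F_def)
qed

text \<open>Averaging over windows: the double sum of \<open>G (m + h)\<close> reproduces the long
  sum \<open>H - 1\<close> times up to boundary terms, while each window is controlled by the local
  exponential sums. A single fixed \<open>H\<close> suffices for given
  \<open>\<epsilon>\<close>.\<close>

lemma local_1_Fourier_uniform_mean_small:
  fixes f \<psi> :: "nat \<Rightarrow> complex" and t :: real
  defines "G \<equiv> \<lambda>n. f n * \<psi> n * cnj (of_nat n powr (\<i> * of_real t))"
  assumes unif: "local_1_Fourier_uniform f"
    and f: "\<And>n. n > 0 \<Longrightarrow> norm (f n) \<le> 1"
    and q: "q > 0" and per: "\<And>n. \<psi> (n + q) = \<psi> n" and \<psi>: "\<And>n. norm (\<psi> n) \<le> 1"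
    and \<epsilon>: "\<epsilon> > 0"
  shows "\<forall>\<^sub>F M in sequentially. norm (\<Sum>n\<in>{1..<M}. G n) \<le> \<epsilon> * real M"
proof -
  define F where "F H m = (SUP \<theta>::real. norm (1 / of_nat H *
           (\<Sum>h\<in>{1..<H}. f (m + h) * exp (2 * of_real pi * \<i> * of_nat h * of_real \<theta>))))" for H m :: nat
  \<comment> \<open>Chosen so that \<open>2 * q * \<delta> = \<epsilon> / 2\<close>; the other half
    of \<open>\<epsilon>\<close> is kept for the lower-order terms.\<close>
  define \<delta> where "\<delta> = \<epsilon> / (4 * real q)"
  have \<delta>: "\<delta> > 0" using \<epsilon> q by (simp add: \<delta>_def)
  have "(\<lambda>H. limsup (\<lambda>M. ereal (1 / real M * (\<Sum>m\<in>{1..<M}. F H m)))) \<longlonglongrightarrow> 0"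
    using unif unfolding local_1_Fourier_uniform_def F_def .
  moreover have "0 < ereal \<delta>" using \<delta> by simp
  ultimately have "\<forall>\<^sub>F H in sequentially. limsup (\<lambda>M. ereal (1 / real M * (\<Sum>m\<in>{1..<M}. F H m))) < ereal \<delta>"
    by (rule order_tendstoD(2))
  \<comment> \<open>Windows run over \<open>1 \<le> h < H\<close> and have \<open>H - 1\<close>
    elements; \<open>H \<ge> 2\<close> ensures \<open>H - 1 \<ge> H / 2\<close>.\<close>
  then have "\<forall>\<^sub>F H in sequentially. H \<ge> 2 \<and> limsup (\<lambda>M. ereal (1 / real M * (\<Sum>m\<in>{1..<M}. F H m))) < ereal \<delta>"
    by (intro eventually_conj eventually_ge_at_top)
  then obtain H where H: "H \<ge> 2" and lim: "limsup (\<lambda>M. ereal (1 / real M * (\<Sum>m\<in>{1..<M}. F H m))) < ereal \<delta>"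
    using eventually_happens'[OF sequentially_bot] by blast
  \<comment> \<open>At 0 the twist vanishes, as \<open>0 powr z\<close> is 0 by convention, so the
    arbitrary value \<open>f 0\<close> does no harm.\<close>
  have G_le: "norm (G n) \<le> 1" for n
  proof (cases "n = 0")
    case False
    then have "norm (f n) * norm (\<psi> n) \<le> 1 * 1" using f \<psi> by (intro mult_mono) auto
    then show ?thesis using False by (simp add: G_def norm_mult norm_nat_powr_imaginary)
  qed (simp add: G_def)
  have bound: "norm (\<Sum>n\<in>{1..<M}. G n) \<le>
      2 * real q * (\<Sum>m\<in>{1..<M}. F H m) + (6 * \<bar>t\<bar> * real H * sqrt (real M) + 4 * real H)" for M
  proof -
    let ?A = "\<Sum>n\<in>{1..<M}. G n" and ?D = "\<Sum>m\<in>{1..<M}. \<Sum>h\<in>{1..<H}. G (m + h)"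
    have "norm ?D \<le> (\<Sum>m\<in>{1..<M}. real q * (real H * F H m) + \<bar>t\<bar> * (real H)\<^sup>2 * (1 / real m))"
      unfolding G_def F_def using H f q per \<psi>
      by (intro order_trans[OF norm_sum] sum_mono norm_sum_twist_slow_le) auto
    also have "\<dots> = real q * real H * (\<Sum>m\<in>{1..<M}. F H m) + \<bar>t\<bar> * (real H)\<^sup>2 * (\<Sum>m\<in>{1..<M}. 1 / real m)"
      by (simp only: sum.distrib sum_distrib_left mult.assoc)
    also have "\<dots> \<le> real q * real H * (\<Sum>m\<in>{1..<M}. F H m) + \<bar>t\<bar> * (real H)\<^sup>2 * (3 * sqrt (real M))"
      by (intro add_left_mono mult_left_mono sum_inverse_le_sqrt) auto
    finally have D: "norm ?D \<le> \<dots>" .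
    \<comment> \<open>After exchanging the sums, each \<open>h\<close> contributes a shifted copy of
      the long sum, at distance at most \<open>2 * h\<close> from it.\<close>
    have "?D - of_nat (H - 1) * ?A = (\<Sum>h\<in>{1..<H}. (\<Sum>m\<in>{1..<M}. G (m + h)) - ?A)"
      by (subst sum.swap) (simp add: sum_subtractf)
    also have "norm \<dots> \<le> (\<Sum>h\<in>{1..<H}. 2 * real H)"
      by (intro order_trans[OF norm_sum] sum_mono order_trans[OF norm_sum_shift_le] G_le) auto
    also have "\<dots> = 2 * real H * real (H - 1)" by simp
    also have "\<dots> \<le> 2 * real H * real H" by (intro mult_left_mono) auto
    finally have "norm (?D - of_nat (H - 1) * ?A) \<le> 2 * real H * real H" .
    moreover have "norm (of_nat (H - 1) * ?A) \<le> norm ?D + norm (?D - of_nat (H - 1) * ?A)"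
      by (subst norm_minus_commute) (rule norm_triangle_sub)
    moreover have "norm (of_nat (H - 1) * ?A) = real (H - 1) * norm ?A" by (simp add: norm_mult)
    moreover have "real H / 2 * norm ?A \<le> real (H - 1) * norm ?A"
      using H by (intro mult_right_mono) (auto simp: of_nat_diff)
    ultimately have "real H / 2 * norm ?A \<le> real q * real H * (\<Sum>m\<in>{1..<M}. F H m)
        + \<bar>t\<bar> * (real H)\<^sup>2 * (3 * sqrt (real M)) + 2 * real H * real H"
      using D by linarith
    also have "\<dots> = real H / 2 * (2 * real q * (\<Sum>m\<in>{1..<M}. F H m)
        + (6 * \<bar>t\<bar> * real H * sqrt (real M) + 4 * real H))"
      by (simp add: algebra_simps power2_eq_square)
    finally show ?thesis using H by (simp only: mult_le_cancel_left_pos[of "real H / 2"])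
  qed
  have "\<forall>\<^sub>F M in sequentially. ereal (1 / real M * (\<Sum>m\<in>{1..<M}. F H m)) < ereal \<delta>"
    using lim by (rule Limsup_lessD)
  moreover have "(\<lambda>M. sqrt (real M) / real M) \<longlonglongrightarrow> 0"
  proof -
    have "(\<lambda>M. inverse (sqrt (real M))) \<longlonglongrightarrow> 0"
      by (intro tendsto_inverse_0_at_top filterlim_compose[OF sqrt_at_top filterlim_real_sequentially])
    moreover have "inverse (sqrt (real M)) = sqrt (real M) / real M" for M
      by (simp add: inverse_eq_divide sqrt_divide_self_eq)
    ultimately show ?thesis by simp
  qed
  then have "((\<lambda>M. 6 * \<bar>t\<bar> * real H * (sqrt (real M) / real M) + 4 * real H * (1 / real M)) \<longlongrightarrow>
      6 * \<bar>t\<bar> * real H * 0 + 4 * real H * 0) sequentially"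
    by (intro tendsto_add tendsto_mult_left lim_1_over_n)
  then have "\<forall>\<^sub>F M in sequentially.
      6 * \<bar>t\<bar> * real H * (sqrt (real M) / real M) + 4 * real H * (1 / real M) < \<epsilon> / 2"
    using \<epsilon> by (intro order_tendstoD(2)) auto
  ultimately show ?thesis using eventually_gt_at_top[of 0]
  proof eventually_elim
    case (elim M)
    then have M: "real M > 0" by simp
    have "(\<Sum>m\<in>{1..<M}. F H m) \<le> \<delta> * real M"
      using elim(1) M by (simp add: field_simps)
    then have "2 * real q * (\<Sum>m\<in>{1..<M}. F H m) \<le> 2 * real q * (\<delta> * real M)"
      by (intro mult_left_mono) auto
    also have "\<dots> = \<epsilon> / 2 * real M" using q by (simp add: \<delta>_def)
    finally have "2 * real q * (\<Sum>m\<in>{1..<M}. F H m) \<le> \<epsilon> / 2 * real M" .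
    moreover have "6 * \<bar>t\<bar> * real H * sqrt (real M) + 4 * real H \<le> \<epsilon> / 2 * real M"
      using mult_strict_right_mono[OF elim(2) M] M by (simp add: distrib_right)
    ultimately show ?case using bound[of M] by (simp add: field_simps)
  qed
qed

section \<open>Dirichlet series with small partial sums\<close>

text \<open>Summation by parts: the decreasing weights give nonnegative differences, so the bound on
  the partial sums can be inserted termwise. The identity \<open>const\<close> undoes the summation
  by parts for the majorant.\<close>

lemma norm_weighted_sum_le:
  fixes a :: "nat \<Rightarrow> 'a::real_normed_vector" and w :: "nat \<Rightarrow> real"
  assumes A: "\<And>n. norm (\<Sum>k\<in>{1..n}. a k) \<le> \<epsilon> * real n + C"
    and w: "\<And>n. w n \<ge> 0" "\<And>n. n \<ge> 1 \<Longrightarrow> w (Suc n) \<le> w n"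
  shows "norm (\<Sum>n\<in>{1..N}. w n *\<^sub>R a n) \<le> \<epsilon> * (\<Sum>n\<in>{1..N}. w n) + C * w 1"
proof -
  define S where "S n = (\<Sum>k\<in>{1..n}. a k)" for n
  have abel: "(\<Sum>n\<in>{1..N}. w n *\<^sub>R a n) = w (Suc N) *\<^sub>R S N + (\<Sum>n\<in>{1..N}. (w n - w (Suc n)) *\<^sub>R S n)"
    by (induction N) (simp_all add: S_def algebra_simps)
  have const: "\<epsilon> * (\<Sum>n\<in>{1..N}. w n) + C * w 1 =
      w (Suc N) * (\<epsilon> * real N + C) + (\<Sum>n\<in>{1..N}. (w n - w (Suc n)) * (\<epsilon> * real n + C))"
    by (induction N) (simp_all add: algebra_simps)
  have "norm (w (Suc N) *\<^sub>R S N) \<le> w (Suc N) * (\<epsilon> * real N + C)"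
    using A[of N] w(1) by (simp add: S_def mult_left_mono)
  moreover have "norm (\<Sum>n\<in>{1..N}. (w n - w (Suc n)) *\<^sub>R S n) \<le> (\<Sum>n\<in>{1..N}. (w n - w (Suc n)) * (\<epsilon> * real n + C))"
    using A w(2) by (intro order_trans[OF norm_sum] sum_mono) (simp add: S_def mult_left_mono)
  ultimately show ?thesis unfolding abel const by (rule norm_triangle_mono)
qed

text \<open>As \<open>s\<close> decreases to 1, a uniform bound would pass to every partial sum of
  the harmonic series, which diverges.\<close>

lemma zeta_unbounded:
  assumes "\<And>s. s > 1 \<Longrightarrow> (\<Sum>n. real n powr -s) \<le> K"
  shows False
proof -
  have "harm N \<le> K" for N :: nat
  proof -
    have "((\<lambda>s. \<Sum>n\<in>{1..N}. real n powr -s) \<longlongrightarrow> (\<Sum>n\<in>{1..N}. real n powr -1)) (at_right 1)"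
      by (intro tendsto_sum tendsto_powr tendsto_const tendsto_minus tendsto_ident_at) auto
    moreover have "\<forall>\<^sub>F s in at_right 1. (\<Sum>n\<in>{1..N}. real n powr -s) \<le> K"
    proof (rule eventually_at_right_less[THEN eventually_mono])
      fix s :: real assume s: "1 < s"
      then have "summable (\<lambda>n. real n powr -s)" using summable_real_powr_iff[of "-s"] by simp
      then have "(\<Sum>n\<in>{1..N}. real n powr -s) \<le> (\<Sum>n. real n powr -s)" by (intro sum_le_suminf) auto
      then show "(\<Sum>n\<in>{1..N}. real n powr -s) \<le> K" using assms[OF s] by simp
    qed
    ultimately have "(\<Sum>n\<in>{1..N}. real n powr -1) \<le> K"
      by (rule tendsto_upperbound) simp
    then show ?thesis by (simp add: harm_def powr_minus inverse_eq_divide)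
  qed
  moreover have "\<forall>\<^sub>F N in sequentially. K < harm N"
    using harm_at_top by (simp add: filterlim_at_top_dense)
  then obtain N where "K < harm N" by (metis eventually_happens' sequentially_bot)
  ultimately show False by (meson not_less)
qed

text \<open>Small partial sums bound the series of \<open>G\<close> by \<open>c / 2\<close> times
  zeta plus a constant, whereas the Euler product forces at least \<open>c\<close> times zeta. Zeta
  would then stay bounded as \<open>s\<close> decreases to 1.\<close>

lemma mean_small_contradiction:
  fixes G :: "nat \<Rightarrow> complex"
  assumes one: "G 1 = 1"
    and mult: "\<And>m n. m > 0 \<Longrightarrow> n > 0 \<Longrightarrow> coprime m n \<Longrightarrow> G (m * n) = G m * G n"
    and le1: "\<And>n. norm (G n) \<le> 1"
    and even: "\<And>n. even n \<Longrightarrow> G n = 0"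
    and summ: "(\<lambda>p. 1 / real p * (1 - Re (G p))) summable_on {p. prime p}"
    and mean: "\<And>\<epsilon>. \<epsilon> > 0 \<Longrightarrow> \<forall>\<^sub>F M in sequentially. norm (\<Sum>n\<in>{1..<M}. G n) \<le> \<epsilon> * real M"
  shows False
proof -
  obtain c where c: "c > 0"
    and lower: "\<And>s. s > 1 \<Longrightarrow> c * (\<Sum>n. real n powr -s) \<le> norm (\<Sum>n. G n * of_real (real n powr -s))"
    using dirichlet_series_lower_bound[OF one mult le1 even summ] by blast
  obtain M0 where M0: "\<And>M. M \<ge> M0 \<Longrightarrow> norm (\<Sum>n\<in>{1..<M}. G n) \<le> c / 2 * real M"
    using mean[of "c / 2"] c by (auto simp: eventually_sequentially)
  \<comment> \<open>The summand \<open>c / 2\<close> absorbs the shift from \<open>M = n + 1\<close>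
    to \<open>n\<close>; \<open>M0\<close> covers the initial range by the trivial bound.\<close>
  define C where "C = c / 2 + real M0"
  have A: "norm (\<Sum>k\<in>{1..n}. G k) \<le> c / 2 * real n + C" for n
  proof (cases "Suc n \<ge> M0")
    case True
    then show ?thesis using M0[OF True]
      by (simp add: C_def atLeastLessThanSuc_atLeastAtMost algebra_simps)
  next
    case False
    have "norm (\<Sum>k\<in>{1..n}. G k) \<le> (\<Sum>k\<in>{1..n}. 1)"
      by (intro order_trans[OF norm_sum] sum_mono le1)
    moreover have "0 \<le> c / 2 * real n" using c by simp
    moreover have "real n \<le> C" using False c by (simp add: C_def)
    ultimately show ?thesis by simp
  qed
  have "(\<Sum>n. real n powr -s) \<le> 2 * C / c" if s: "s > 1" for s
  proof -
    define w where "w n = real n powr -s" for n :: nat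
    have w_summable: "summable w"
      using s summable_real_powr_iff[of "-s"] unfolding w_def by simp
    have "summable (\<lambda>n. G n * of_real (w n))"
    proof (rule summable_norm_cancel, rule summable_comparison_test[OF _ w_summable], intro exI allI impI)
      show "norm (norm (G n * of_real (w n))) \<le> w n" for n
        using le1[of n] by (simp add: norm_mult w_def mult_left_le_one_le)
    qed
    then have "(\<lambda>N. \<Sum>n\<in>{..N}. G n * of_real (w n)) \<longlonglongrightarrow> (\<Sum>n. G n * of_real (w n))"
      by (rule summable_LIMSEQ')
    then have lim1: "(\<lambda>N. norm (\<Sum>n\<in>{..N}. G n * of_real (w n))) \<longlonglongrightarrow> norm (\<Sum>n. G n * of_real (w n))"
      by (rule tendsto_norm)
    have lim2: "(\<lambda>N. c / 2 * (\<Sum>n\<in>{..N}. w n) + C) \<longlonglongrightarrow> c / 2 * suminf w + C"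
      by (intro tendsto_intros summable_LIMSEQ' w_summable)
    have "norm (\<Sum>n\<in>{..N}. G n * of_real (w n)) \<le> c / 2 * (\<Sum>n\<in>{..N}. w n) + C" for N
    proof -
      have "(\<Sum>n\<in>{..N}. G n * of_real (w n)) = (\<Sum>n\<in>{1..N}. w n *\<^sub>R G n)"
        by (rule sum.mono_neutral_cong_right) (auto simp: w_def scaleR_conv_of_real)
      moreover have "(\<Sum>n\<in>{..N}. w n) = (\<Sum>n\<in>{1..N}. w n)"
        by (rule sum.mono_neutral_right) (auto simp: w_def)
      moreover have "norm (\<Sum>n\<in>{1..N}. w n *\<^sub>R G n) \<le> c / 2 * (\<Sum>n\<in>{1..N}. w n) + C * w 1"
        using s by (intro norm_weighted_sum_le A) (auto simp: w_def intro: powr_mono2')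
      ultimately show ?thesis by (simp add: w_def)
    qed
    then have "norm (\<Sum>n. G n * of_real (w n)) \<le> c / 2 * suminf w + C"
      by (intro LIMSEQ_le[OF lim1 lim2]) auto
    moreover have "c * suminf w \<le> norm (\<Sum>n. G n * of_real (w n))"
      using lower[OF s] by (simp only: w_def[abs_def])
    ultimately have "suminf w \<le> 2 * C / c" using c by (simp add: field_simps)
    then show ?thesis by (simp only: w_def[abs_def])
  qed
  then show False by (rule zeta_unbounded)
qed

section \<open>The twisted function attached to a pretentious \<open>f\<close>\<close>

theorem proposition0p7:
  fixes f :: "nat \<Rightarrow> complex"
  assumes "bounded_multiplicative f"
    and "pretentious f"
  shows "\<not> local_1_Fourier_uniform f"
proof
  assume unif: "local_1_Fourier_uniform f"
  obtain q chi and t :: real where chi: "dirichlet_character q chi"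
    and summ: "(\<lambda>p. 1 / real p * (1 - Re (f p * cnj (chi p * of_nat p powr (\<i> * of_real t))))) summable_on {p. prime p}"
    using assms(2) by (auto simp: pretentious_def)
  have q: "q > 0" and chi_per: "\<And>n. chi (n + q) = chi n" and chi_mult: "\<And>a b. chi (a * b) = chi a * chi b"
    and chi0: "\<And>a. chi a \<noteq> 0 \<longleftrightarrow> coprime a q"
    using chi by (auto simp: dirichlet_character_def)
  have "chi 1 * chi 1 = chi 1" "chi 1 \<noteq> 0" using chi_mult[of 1 1] chi0[of 1] by auto
  then have chi1: "chi 1 = 1" by simp
  \<comment> \<open>Multiplicativity allows \<open>f 1 = 0\<close>; changing the value at 1 is harmless because local uniformity
     only involves \<open>f (m + h)\<close> with \<open>m, h \<ge> 1\<close> and pretentiousness only values at primes.\<close>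
  define F where "F n = (if n = 1 then 1 else f n)" for n
  define \<psi> where "\<psi> n = (if odd n then cnj (chi n) else 0)" for n
  define G where "G n = F n * \<psi> n * cnj (of_nat n powr (\<i> * of_real t))" for n
  have F_le: "norm (F n) \<le> 1" if "n > 0" for n
    using assms(1) that by (simp add: F_def bounded_multiplicative_def)
  have F_mult: "F (m * n) = F m * F n" if "m > 0" "n > 0" "coprime m n" for m n
  proof (cases "m = 1 \<or> n = 1")
    case False
    then show ?thesis using assms(1) that by (auto simp: F_def bounded_multiplicative_def)
  qed (auto simp: F_def)
  have \<psi>_le: "norm (\<psi> n) \<le> 1" for n
    using norm_dirichlet_character_le_1[OF chi] by (simp add: \<psi>_def)
  \<comment> \<open>Restriction to odd numbers doubles the period: a shift by \<open>2 * q\<close>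
    preserves both parity and the residue modulo \<open>q\<close>.\<close>
  have \<psi>_per: "\<psi> (n + 2 * q) = \<psi> n" for n
    using periodic_mult[of chi q n 2, OF chi_per] by (simp add: \<psi>_def)
  have unif_F: "local_1_Fourier_uniform F"
  proof -
    have "(\<Sum>h\<in>{1..<H}. F (m + h) * e h) = (\<Sum>h\<in>{1..<H}. f (m + h) * e h)" if "m \<in> {1..<M}" for m M H e
      using that by (intro sum.cong) (auto simp: F_def)
    then have "(\<Sum>m\<in>{1..<M}. SUP \<theta>::real. norm (1 / of_nat H *
           (\<Sum>h\<in>{1..<H}. F (m + h) * exp (2 * of_real pi * \<i> * of_nat h * of_real \<theta>)))) =
        (\<Sum>m\<in>{1..<M}. SUP \<theta>::real. norm (1 / of_nat H *
           (\<Sum>h\<in>{1..<H}. f (m + h) * exp (2 * of_real pi * \<i> * of_nat h * of_real \<theta>))))" for H M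
      by (intro sum.cong refl) (simp only:)
    then show ?thesis using unif unfolding local_1_Fourier_uniform_def by (simp only:)
  qed
  show False
  proof (rule mean_small_contradiction[of G])
    show "G 1 = 1" using chi1 by (simp add: G_def F_def \<psi>_def)
    show "G (m * n) = G m * G n" if "m > 0" "n > 0" "coprime m n" for m n
      using that by (simp add: G_def F_mult \<psi>_def chi_mult powr_times_real)
    show "norm (G n) \<le> 1" for n
    proof (cases "n = 0")
      case False
      then have "norm (F n) * norm (\<psi> n) \<le> 1 * 1" using F_le \<psi>_le by (intro mult_mono) auto
      then show ?thesis using False by (simp add: G_def norm_mult norm_nat_powr_imaginary)
    qed (simp add: G_def)
    show "G n = 0" if "even n" for n using that by (simp add: G_def \<psi>_def)
    show "\<forall>\<^sub>F M in sequentially. norm (\<Sum>n\<in>{1..<M}. G n) \<le> \<epsilon> * real M" if "\<epsilon> > 0" for \<epsilon>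
      unfolding G_def using unif_F F_le q \<psi>_per \<psi>_le that
      by (intro local_1_Fourier_uniform_mean_small[where q = "2 * q"]) auto
    \<comment> \<open>At odd primes \<open>G p\<close> is exactly the product in the pretentiousness
      series. Only the term at 2 differs, and changing one term preserves summability.\<close>
    have "(\<lambda>p. 1 / real p * (1 - Re (f p * cnj (chi p * of_nat p powr (\<i> * of_real t))))) summable_on ({p. prime p} - {2})"
      using summ by (rule summable_on_subset_banach) auto
    then have "(\<lambda>p. 1 / real p * (1 - Re (G p))) summable_on ({p. prime p} - {2})"
    proof (rule summable_on_cong[THEN iffD1, rotated])
      fix p :: nat assume "p \<in> {p. prime p} - {2}"
      then have "odd p" "p \<noteq> 1" using primes_dvd_imp_eq[of 2 p] by (auto simp: two_is_prime_nat)
      then show "1 / real p * (1 - Re (f p * cnj (chi p * of_nat p powr (\<i> * of_real t)))) = 1 / real p * (1 - Re (G p))"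
        by (simp add: G_def F_def \<psi>_def mult.assoc)
    qed
    then have "(\<lambda>p. 1 / real p * (1 - Re (G p))) summable_on (insert 2 ({p. prime p} - {2}))"
      by (subst summable_on_insert_iff)
    then show "(\<lambda>p. 1 / real p * (1 - Re (G p))) summable_on {p. prime p}"
      by (simp add: insert_absorb two_is_prime_nat)
  qed
qed

end
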